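(* Let $P$ be the boundary word of a prime double square, $P=w_1w_2w_3w_4\overline{w}_1\overline{w}_2\overline{w}_3\overline{w}_4$, with associated words $u_1,\dots,u_4$ and exponents $n_1,\dots,n_4\ge 0$, and with the starting point (the cyclic indexing) chosen so that $|u_1|\le|u_i|$ for $i=2,3,4$. Then there exist nonempty words $k,p\in\Sigma^*$ with $u_2=k\tilde{u}_1$ and $u_4=\widehat{u}_1\overline{p}$ such that one of the following holds (the exponents written being the positive ones, all other $n_i$ being $0$): (a) all $n_i=0$, $k$ and $p$ are palindromes, and $w_1=u_1$, $w_2=k\tilde{u}_1$, $w_3=u_3$, $w_4=\widehat{u}_1\overline{p}$; (b) only $n_1>0$, $k$ and $p$ are palindromes, and $w_1=(u_1k\tilde{u}_1p)^{n_1}u_1$, $w_2=k\tilde{u}_1$, $w_3=u_3$, $w_4=\widehat{u}_1\overline{p}$; (c) only $n_2>0$, $p$ is a palindrome, and $w_1=u_1$, $w_2=(\tilde{u}_3u_1)^{n_2}k\tilde{u}_1$, $w_3=u_3$, $w_4=\widehat{u}_1\overline{p}$; (d) only $n_3>0$, $k$ and $p$ are palindromes, and $w_1=u_1$, $w_2=k\tilde{u}_1$, $w_3=(\overline{p}\,\overline{u}_1k\tilde{u}_1)^{n_3}u_3$, $w_4=\widehat{u}_1\overline{p}$; (e) only $n_4>0$, $k$ is a palindrome, and $w_1=u_1$, $w_2=k\tilde{u}_1$, $w_3=u_3$, $w_4=(\widehat{u}_1u_3)^{n_4}\widehat{u}_1\overline{p}$; (f) only $n_1,n_3>0$, $k$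 and $p$ are palindromes, and $w_1=(u_1k\tilde{u}_1p)^{n_1}u_1$, $w_2=k\tilde{u}_1$, $w_3=(\overline{p}\,\overline{u}_1k\tilde{u}_1)^{n_3}u_3$, $w_4=\widehat{u}_1\overline{p}$; (g) only $n_2,n_4>0$, and $w_1=u_1$, $w_2=(\tilde{u}_3u_1)^{n_2}k\tilde{u}_1$, $w_3=u_3$, $w_4=(\widehat{u}_1u_3)^{n_4}\widehat{u}_1\overline{p}$.
   Context: Words. $\Sigma=\{0,1,\overline{0},\overline{1}\}$, whose letters encode unit steps right, up, left, down in $\mathbb{Z}^2$; conjugation exchanges $0\leftrightarrow\overline{0}$ and $1\leftrightarrow\overline{1}$. For $w=w_1\cdots w_n\in\Sigma^*$: $\overline{w}$ is obtained by conjugating each letter, $\tilde{w}=w_n\cdots w_1$ is the reversal, and $\widehat{w}=\tilde{\overline{w}}$. A palindrome is a word with $w=\tilde w$. $|w|$ is the length and $|w|_\alpha$ the number of occurrences of $\alpha$. Boundary words. The boundary of a polyomino is coded by a word $P$ over $\Sigma$, regarded as a circular word (defined up to the starting point; factors may wrap around), describing a closed non-self-intersecting lattice path of length at least $4$: $|P|_\alpha=|P|_{\overline\alpha}$ for $\alpha=0,1$, and no nonempty proper factor $Q$ of the circular word satisfies both $|Q|_0=|Q|_{\overline 0}$ and $|Q|_1=|Q|_{\overline 1}$. The simple square is coded by $01\overline{0}\,\overline{1}$. Double squares. A double square is a polyomino whose boundary word has two different factorizations $P=AB\widehat{A}\widehat{B}=XY\widehat{X}\widehat{Y}$ (as circular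 words); equivalently $P=w_1w_2\cdots w_8$ (as a circular word) with all $w_i$ nonempty, $A=w_1w_2$, $B=w_3w_4$, $\widehat{A}=w_5w_6$, $\widehat{B}=w_7w_8$, $X=w_2w_3$, $Y=w_4w_5$, $\widehat{X}=w_6w_7$, $\widehat{Y}=w_8w_1$. Primality. A homologous morphism is a monoid morphism $\varphi:\Sigma^*\to\Sigma^*$ with $\varphi(\widehat{A})=\widehat{\varphi(A)}$ for all $A\in\Sigma^*$. A double square with boundary word $P$ is prime if, for every homologous morphism $\varphi$ and every boundary word $U$ of a polyomino with $P=\varphi(U)$ (as circular words), either $U=P$ or $U$ is the boundary word of the simple square; here equality of boundary words is understood up to starting point and up to a permutation of $\Sigma$ commuting with conjugation (i.e. up to rotations and reflections of the plane). Known facts fixing the notation. For a prime double square, $A,B,X,Y$ are palindromes and $w_{i+4}=\overline{w}_i$ for $i=1,\dots,4$. For every double square and every $i=1,\dots,8$ (indices mod 8) there are $u_i,v_i\in\Sigma^*$ and $n_i\ge0$ with $w_i=(u_iv_i)^{n_i}u_i$ and $\widehat{w}_{i-3}w_{i-1}=u_iv_i$; in the prime case these are taken with $u_{i+4}=\overline{u}_i$, $v_{i+4}=\overline{v}_i$, $n_{i+4}=n_i$. It is also known that in the prime case no two cyclically consecutive exponents among $n_1,n_2,n_3,n_4$ are both positive. *)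

theory Defs
  imports Main "HOL-Library.Sublist"
begin

text \<open>
  The letters \<open>R\<close>, \<open>U\<close>, \<open>L\<close>, \<open>D\<close> are the unit steps right, up, left, down, written
  \<open>0\<close>, \<open>1\<close>, \<open>0\<close> barred, \<open>1\<close> barred in the literature.
\<close>

datatype letter = R | U | L | D

type_synonym word = "letter list"

fun conj_letter :: "letter \<Rightarrow> letter" where
  "conj_letter R = L"
| "conj_letter L = R"
| "conj_letter U = D"
| "conj_letter D = U"

definition bar :: "word \<Rightarrow> word" where
  "bar w = map conj_letter w"

definition hat :: "word \<Rightarrow> word" where
  "hat w = rev (bar w)"

definition palindrome :: "word \<Rightarrow> bool" where
  "palindrome w \<longleftrightarrow> rev w = w"

definition word_pow :: "word \<Rightarrow> nat \<Rightarrow> word" where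
  "word_pow w n = concat (replicate n w)"

definition circ_eq :: "word \<Rightarrow> word \<Rightarrow> bool" where
  "circ_eq P Q \<longleftrightarrow> (\<exists>m. Q = rotate m P)"

definition closed_path :: "word \<Rightarrow> bool" where
  "closed_path w \<longleftrightarrow> count_list w R = count_list w L \<and> count_list w U = count_list w D"

text \<open>Both orientations of the boundary are admitted. Factors may wrap around, hence the rotations.\<close>

definition boundary_word :: "word \<Rightarrow> bool" where
  "boundary_word P \<longleftrightarrow> 4 \<le> length P \<and> closed_path P \<and>
     (\<forall>m Q. sublist Q (rotate m P) \<and> Q \<noteq> [] \<and> length Q < length P \<longrightarrow> \<not> closed_path Q)"

text \<open>Equality up to the starting point and up to a permutation of the alphabet commuting with
  conjugation, that is, up to rotations and reflections of the plane.\<close>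

definition same_boundary :: "word \<Rightarrow> word \<Rightarrow> bool" where
  "same_boundary P Q \<longleftrightarrow>
     (\<exists>\<rho>. bij \<rho> \<and> (\<forall>a. \<rho> (conj_letter a) = conj_letter (\<rho> a)) \<and> circ_eq (map \<rho> P) Q)"

definition homologous_morphism :: "(word \<Rightarrow> word) \<Rightarrow> bool" where
  "homologous_morphism \<phi> \<longleftrightarrow>
     (\<forall>x y. \<phi> (x @ y) = \<phi> x @ \<phi> y) \<and> (\<forall>A. \<phi> (hat A) = hat (\<phi> A))"

text \<open>
  Cyclic indices modulo 8 are modelled by 8-periodic families indexed by \<open>int\<close>. With
  \<open>A = w 1 @ w 2\<close>, \<open>B = w 3 @ w 4\<close>, \<open>X = w 2 @ w 3\<close>, \<open>Y = w 4 @ w 5\<close>, the word \<open>P\<close> is, as a circular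
  word, both \<open>A @ B @ hat A @ hat B\<close> and \<open>X @ Y @ hat X @ hat Y\<close>; nonemptiness of all
  \<open>w i\<close> makes these two factorizations different.
\<close>

definition double_square_factorization :: "word \<Rightarrow> (int \<Rightarrow> word) \<Rightarrow> bool" where
  "double_square_factorization P w \<longleftrightarrow>
     (\<forall>i. w (i + 8) = w i) \<and> (\<forall>i. w i \<noteq> []) \<and>
     circ_eq P (w 1 @ w 2 @ w 3 @ w 4 @ w 5 @ w 6 @ w 7 @ w 8) \<and>
     w 5 @ w 6 = hat (w 1 @ w 2) \<and> w 7 @ w 8 = hat (w 3 @ w 4) \<and>
     w 6 @ w 7 = hat (w 2 @ w 3) \<and> w 8 @ w 1 = hat (w 4 @ w 5)"

definition double_square :: "word \<Rightarrow> bool" where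
  "double_square P \<longleftrightarrow> boundary_word P \<and> (\<exists>w. double_square_factorization P w)"

definition prime_double_square :: "word \<Rightarrow> bool" where
  "prime_double_square P \<longleftrightarrow> double_square P \<and>
     (\<forall>\<phi> V. homologous_morphism \<phi> \<and> boundary_word V \<and> circ_eq P (\<phi> V) \<longrightarrow>
        same_boundary V P \<or> same_boundary V [R, U, L, D])"

text \<open>
  The associated words and exponents of an antipodal factorization (\<open>w (i + 4) = bar (w i)\<close>).
  As usual, \<open>v i\<close> is allowed to be empty, so they are not claimed to be unique.
\<close>

definition associated_words ::
    "(int \<Rightarrow> word) \<Rightarrow> (int \<Rightarrow> word) \<Rightarrow> (int \<Rightarrow> word) \<Rightarrow> (int \<Rightarrow> nat) \<Rightarrow> bool" where
  "associated_words w u v n \<longleftrightarrow>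
     (\<forall>i. w i = word_pow (u i @ v i) (n i) @ u i) \<and>
     (\<forall>i. hat (w (i - 3)) @ w (i - 1) = u i @ v i) \<and>
     (\<forall>i. u (i + 4) = bar (u i)) \<and> (\<forall>i. v (i + 4) = bar (v i)) \<and> (\<forall>i. n (i + 4) = n i)"

end

theory Submission
  imports Defs
begin

text \<open>
  Since \<open>w (i + 4) = bar (w i)\<close>, the words \<open>w 1 @ w 2\<close>, \<open>w 2 @ w 3\<close>, \<open>w 3 @ w 4\<close> and
  \<open>w 4 @ bar (w 1)\<close> are palindromes. As \<open>u i\<close> is both a prefix and a suffix of \<open>w i\<close> and \<open>u 1\<close> is
  shortest, the first and last of these palindromes give \<open>k\<close> and \<open>p\<close>. Comparing lengths, no two
  cyclically consecutive exponents are positive. If \<open>k\<close> were empty, then \<open>w 3\<close> would end in \<open>u 1\<close>,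
  while \<open>w 4\<close> starts with \<open>hat (u 1)\<close>, so that the path would run back along \<open>u 1\<close>; likewise, if \<open>p\<close>
  were empty, then \<open>w 3\<close> would start with \<open>bar (u 1)\<close>, while \<open>w 2\<close> ends in \<open>rev (u 1)\<close>.
\<close>

lemma conj_letter_conj_letter [simp]: "conj_letter (conj_letter a) = a"
  by (cases a) auto

lemma bar_Nil [simp]: "bar [] = []"
  and bar_append [simp]: "bar (x @ y) = bar x @ bar y"
  and bar_rev: "bar (rev x) = rev (bar x)"
  and length_bar [simp]: "length (bar x) = length x"
  and bar_bar [simp]: "bar (bar x) = x"
  and hat_eq: "hat x = rev (bar x)"
  by (simp_all add: bar_def hat_def rev_map comp_def)

lemma bar_eq_iff: "bar x = bar y \<longleftrightarrow> x = y"
  by (metis bar_bar)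

text \<open>\<open>hat x\<close> is the reversal of \<open>bar x\<close>, and \<open>bar\<close> is
  injective and commutes with reversal. This turns the hat equations of an antipodal factorization
  into palindromes.\<close>

lemma bar_eq_hat_iff: "bar x = hat x \<longleftrightarrow> palindrome x"
  by (metis bar_eq_iff bar_rev hat_eq palindrome_def)

lemma word_pow_0 [simp]: "word_pow x 0 = []"
  and word_pow_Suc: "word_pow x (Suc m) = x @ word_pow x m"
  by (simp_all add: word_pow_def)

lemma word_pow_Suc_right: "word_pow x (Suc m) = word_pow x m @ x"
  by (induction m) (simp_all add: word_pow_Suc)

lemma bar_word_pow: "bar (word_pow x m) = word_pow (bar x) m"
  by (induction m) (simp_all add: word_pow_Suc)

lemma prefix_word_pow: "prefix x (word_pow (x @ y) m @ x)"
  by (cases m) (auto simp: word_pow_Suc)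

lemma closed_path_append_hat: "closed_path (x @ hat x)"
proof (induction x)
  case (Cons a x)
  then show ?case
    by (cases a) (auto simp: closed_path_def hat_def bar_def)
qed (simp add: closed_path_def hat_def bar_def)

text \<open>The path \<open>x @ hat x\<close> walks along \<open>x\<close> and straight back, so it
  is closed. A nonempty \<open>y\<close> makes it a proper factor of the circular word, where
  nonempty closed factors are forbidden.\<close>

lemma boundary_word_no_backtrack:
  assumes "boundary_word P" "circ_eq P (y @ x @ hat x @ z)" "y \<noteq> []"
  shows "x = []"
proof (rule ccontr)
  assume x: "x \<noteq> []"
  obtain m where m: "rotate m P = y @ x @ hat x @ z"
    using assms(2) by (auto simp: circ_eq_def)
  then have "sublist (x @ hat x) (rotate m P)"
    by (metis append.assoc sublist_appendI)
  moreover have "length (x @ hat x) < length P"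
    using arg_cong[OF m, of length] assms(3) by (simp add: hat_eq)
  ultimately show False
    using assms(1) x closed_path_append_hat[of x] by (auto simp: boundary_word_def)
qed

text \<open>Reversal carries the prefix \<open>a\<close> to a suffix \<open>rev a\<close> of the
  whole palindrome; the length bound keeps this suffix inside \<open>y\<close>.\<close>

lemma palindrome_append_suffix:
  assumes "palindrome (x @ y)" "prefix a x" "length a \<le> length y"
  shows "suffix (rev a) y"
proof -
  have "suffix (rev a) (x @ y)"
    using assms(1,2) by (metis palindrome_def prefix_prefix rev_rev_ident suffix_to_prefix)
  then show ?thesis
    using assms(3) by (metis length_rev suffix_appendI suffix_length_suffix suffix_order.refl)
qed

lemma palindrome_append_prefix:
  assumes "palindrome (x @ y)" "suffix a y" "length a \<le> length x"
  shows "prefix (rev a) x"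
proof -
  have "palindrome (rev y @ rev x)"
    using assms(1) by (metis palindrome_def rev_append)
  then show ?thesis
    using palindrome_append_suffix[of "rev y" "rev x" "rev a"] assms(2,3)
    by (simp add: suffix_to_prefix)
qed

lemma palindrome_prefix_suffix_eq:
  assumes "palindrome x" "prefix a x" "suffix b x" "length a = length b"
  shows "b = rev a"
proof -
  have "prefix (rev b) x"
    using assms(1,3) by (metis palindrome_def suffix_to_prefix)
  then have "rev b = a"
    using assms(2,4) by (metis append_eq_conv_conj length_rev prefixE)
  then show ?thesis
    by auto
qed

theorem theorem3:
  fixes P :: word and w u v :: "int \<Rightarrow> word" and n :: "int \<Rightarrow> nat"
  assumes "prime_double_square P"
    and "double_square_factorization P w"
    and "\<forall>i. w (i + 4) = bar (w i)"
    and "associated_words w u v n"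
    and "\<forall>i\<in>{2, 3, 4}. length (u 1) \<le> length (u i)"
  shows "\<exists>k p. k \<noteq> [] \<and> p \<noteq> [] \<and> u 2 = k @ rev (u 1) \<and> u 4 = hat (u 1) @ bar p \<and>
    ((n 1 = 0 \<and> n 2 = 0 \<and> n 3 = 0 \<and> n 4 = 0 \<and> palindrome k \<and> palindrome p \<and>
        w 1 = u 1 \<and>
        w 2 = k @ rev (u 1) \<and>
        w 3 = u 3 \<and>
        w 4 = hat (u 1) @ bar p)
   \<or> (n 1 > 0 \<and> n 2 = 0 \<and> n 3 = 0 \<and> n 4 = 0 \<and> palindrome k \<and> palindrome p \<and>
        w 1 = word_pow (u 1 @ k @ rev (u 1) @ p) (n 1) @ u 1 \<and>
        w 2 = k @ rev (u 1) \<and>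
        w 3 = u 3 \<and>
        w 4 = hat (u 1) @ bar p)
   \<or> (n 1 = 0 \<and> n 2 > 0 \<and> n 3 = 0 \<and> n 4 = 0 \<and> palindrome p \<and>
        w 1 = u 1 \<and>
        w 2 = word_pow (rev (u 3) @ u 1) (n 2) @ k @ rev (u 1) \<and>
        w 3 = u 3 \<and>
        w 4 = hat (u 1) @ bar p)
   \<or> (n 1 = 0 \<and> n 2 = 0 \<and> n 3 > 0 \<and> n 4 = 0 \<and> palindrome k \<and> palindrome p \<and>
        w 1 = u 1 \<and>
        w 2 = k @ rev (u 1) \<and>
        w 3 = word_pow (bar p @ bar (u 1) @ k @ rev (u 1)) (n 3) @ u 3 \<and>
        w 4 = hat (u 1) @ bar p)
   \<or> (n 1 = 0 \<and> n 2 = 0 \<and> n 3 = 0 \<and> n 4 > 0 \<and> palindrome k \<and>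
        w 1 = u 1 \<and>
        w 2 = k @ rev (u 1) \<and>
        w 3 = u 3 \<and>
        w 4 = word_pow (hat (u 1) @ u 3) (n 4) @ hat (u 1) @ bar p)
   \<or> (n 1 > 0 \<and> n 2 = 0 \<and> n 3 > 0 \<and> n 4 = 0 \<and> palindrome k \<and> palindrome p \<and>
        w 1 = word_pow (u 1 @ k @ rev (u 1) @ p) (n 1) @ u 1 \<and>
        w 2 = k @ rev (u 1) \<and>
        w 3 = word_pow (bar p @ bar (u 1) @ k @ rev (u 1)) (n 3) @ u 3 \<and>
        w 4 = hat (u 1) @ bar p)
   \<or> (n 1 = 0 \<and> n 2 > 0 \<and> n 3 = 0 \<and> n 4 > 0 \<and>
        w 1 = u 1 \<and>
        w 2 = word_pow (rev (u 3) @ u 1) (n 2) @ k @ rev (u 1) \<and>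
        w 3 = u 3 \<and>
        w 4 = word_pow (hat (u 1) @ u 3) (n 4) @ hat (u 1) @ bar p))"
proof -

  \<comment> \<open>Antipodal symmetry, palindromes and periods\<close>
  define u1 u2 u3 u4 where "u1 = u 1" and "u2 = u 2" and "u3 = u 3" and "u4 = u 4"
  define w1 w2 w3 w4 where "w1 = w 1" and "w2 = w 2" and "w3 = w 3" and "w4 = w 4"
  note defs = u1_def u2_def u3_def u4_def w1_def w2_def w3_def w4_def
  have per: "w (i + 4) = bar (w i)" for i
    using assms(3) by blast
  have w5: "w 5 = bar w1" and w6: "w 6 = bar w2" and w7: "w 7 = bar w3" and w8: "w 8 = bar w4"
    using per[of 1] per[of 2] per[of 3] per[of 4] by (simp_all add: defs)
  have w0: "w 0 = bar w4" and wm1: "w (- 1) = bar w3" and wm2: "w (- 2) = bar w2"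
    using per[of 0] per[of "- 1"] per[of "- 2"] by (simp_all add: defs)
  have bdry: "boundary_word P"
    using assms(1) by (simp add: prime_double_square_def double_square_def)
  have fac: "circ_eq P (w1 @ w2 @ w3 @ w4 @ w 5 @ w 6 @ w 7 @ w 8)"
      "w 5 @ w 6 = hat (w1 @ w2)" "w 7 @ w 8 = hat (w3 @ w4)"
      "w 6 @ w 7 = hat (w2 @ w3)" "w 8 @ w1 = hat (w4 @ w 5)"
    and ne: "w1 \<noteq> []" "w2 \<noteq> []" "w3 \<noteq> []" "w4 \<noteq> []"
    using assms(2) unfolding double_square_factorization_def defs by blast+
  have pal12: "palindrome (w1 @ w2)" and pal34: "palindrome (w3 @ w4)"
    and pal23: "palindrome (w2 @ w3)"
    using fac(2-4) unfolding w5 w6 w7 w8 bar_append[symmetric] bar_eq_hat_iff by blast+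
  \<comment> \<open>Here the hat equation reads \<open>bar w4 @ w1 = hat (w4 @ bar w1)\<close>;
    conjugating both sides leaves a plain reversal.\<close>
  have pal45: "palindrome (w4 @ bar w1)"
    using arg_cong[OF fac(5), of bar]
    by (simp add: w5 w8 hat_eq palindrome_def bar_rev)
  have W: "w i = word_pow (u i @ v i) (n i) @ u i" and UV: "hat (w (i - 3)) @ w (i - 1) = u i @ v i" for i
    using assms(4) by (auto simp: associated_words_def)
  have uv1: "u1 @ v 1 = rev w2 @ bar w4" and uv2: "u2 @ v 2 = rev w3 @ w1"
    and uv3: "u3 @ v 3 = rev w4 @ w2" and uv4: "u4 @ v 4 = hat w1 @ w3"
    using UV[of 1] UV[of 2] UV[of 3] UV[of 4] by (simp_all add: w0 wm1 wm2 hat_eq flip: defs)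
  have W1: "w1 = word_pow (rev w2 @ bar w4) (n 1) @ u1"
    and W2: "w2 = word_pow (rev w3 @ w1) (n 2) @ u2"
    and W3: "w3 = word_pow (rev w4 @ w2) (n 3) @ u3"
    and W4: "w4 = word_pow (hat w1 @ w3) (n 4) @ u4"
    using W[of 1] W[of 2] W[of 3] W[of 4] uv1 uv2 uv3 uv4 by (simp_all flip: defs)
  have pre: "prefix u1 w1" "prefix u2 w2" "prefix u3 w3" "prefix u4 w4"
    using W prefix_word_pow unfolding defs by metis+
  have suf: "suffix u1 w1" "suffix u2 w2" "suffix u3 w3" "suffix u4 w4"
    using W1 W2 W3 W4 by (metis suffixI)+
  have len: "length u1 \<le> length u2" "length u1 \<le> length u3" "length u1 \<le> length u4"
    using assms(5) by (auto simp: defs)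
  have lenw: "length u2 \<le> length w2" "length u3 \<le> length w3" "length u4 \<le> length w4"
    using pre by (auto dest: prefix_length_le)

  \<comment> \<open>A positive exponent puts a whole period into \<open>w i\<close>, and the length
    of that period is the sum of those of the two neighbours of \<open>w i\<close>.\<close>
  have pos1: "length w2 + length w4 \<le> length w1" if "n 1 > 0"
    using arg_cong[OF W1, of length] that by (cases "n 1") (auto simp: word_pow_Suc)
  have pos2: "length w1 + length w3 \<le> length w2" if "n 2 > 0"
    using arg_cong[OF W2, of length] that by (cases "n 2") (auto simp: word_pow_Suc)
  have pos3: "length w2 + length w4 \<le> length w3" if "n 3 > 0"
    using arg_cong[OF W3, of length] that by (cases "n 3") (auto simp: word_pow_Suc)
  have pos4: "length w1 + length w3 \<le> length w4" if "n 4 > 0"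
    using arg_cong[OF W4, of length] that by (cases "n 4") (auto simp: word_pow_Suc hat_eq)
  \<comment> \<open>If an exponent of odd index and one of even index were both positive, each of
    the two blocks would be strictly longer than the other.\<close>
  have excl: "(n 1 = 0 \<and> n 3 = 0) \<or> (n 2 = 0 \<and> n 4 = 0)"
    using pos1 pos2 pos3 pos4 ne[folded length_greater_0_conv] by linarith

  \<comment> \<open>The palindrome \<open>w1 @ w2\<close> mirrors the prefix \<open>u1\<close> of
    \<open>w1\<close> into \<open>w2\<close>; since \<open>u2\<close> is a suffix of
    \<open>w2\<close> no shorter than \<open>u1\<close>, it catches the mirrored copy.\<close>
  have "suffix (rev u1) w2"
    using palindrome_append_suffix[OF pal12 pre(1)] len(1) lenw(1) by simp
  then have "suffix (rev u1) u2"
    using suf(2) len(1) by (metis length_rev suffix_length_suffix)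
  then obtain k where k: "u2 = k @ rev u1"
    by (auto simp: suffix_def)
  have "suffix (bar u1) (bar w1)"
    using suf(1) by (auto simp: suffix_def)
  then have "prefix (hat u1) w4"
    using palindrome_append_prefix[OF pal45] len(3) lenw(3) by (simp add: hat_eq)
  then have "prefix (hat u1) u4"
    using pre(4) len(3) by (metis hat_eq length_bar length_rev prefix_length_prefix)
  then obtain p where p: "u4 = hat u1 @ bar p"
    by (metis bar_bar prefixE)

  \<comment> \<open>Nonemptiness of \<open>k\<close> and \<open>p\<close>\<close>
  have k_ne: "k \<noteq> []"
  proof
    assume "k = []"
    with k have u2: "u2 = rev u1"
      by simp
    have "suffix u1 w3"
    proof (cases "n 2")
      case 0
      then have "prefix (rev u1) w2"
        using W2 u2 by simp
      then show ?thesis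
        using palindrome_append_suffix[OF pal23] len(2) lenw(2) by fastforce
    next
      case (Suc m)
      then have n: "n 1 = 0" "n 3 = 0"
        using excl by auto
      then have w1: "w1 = u1"
        using W1 by simp
      \<comment> \<open>Two suffixes of \<open>w1 @ w2\<close> are compared:
        \<open>w3 @ rev u1\<close>, mirrored from the prefix up to the first \<open>rev w3\<close>,
        and \<open>u1 @ rev u1\<close>, the end of the last period followed by \<open>u2\<close>.
        The second is no longer, so \<open>w3\<close> ends in \<open>u1\<close>.\<close>
      have "w1 @ w2 = (w1 @ rev w3) @ (w1 @ word_pow (rev w3 @ w1) m @ u2)"
        using W2 Suc by (simp add: word_pow_Suc)
      then have "prefix (w1 @ rev w3) (w1 @ w2)"
        by simp
      then have "suffix (rev (w1 @ rev w3)) (w1 @ w2)"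
        using pal12 by (metis palindrome_def rev_rev_ident suffix_to_prefix)
      then have suf_w3: "suffix (w3 @ rev u1) (w1 @ w2)"
        by (simp add: w1)
      have "w1 @ w2 = (w1 @ word_pow (rev w3 @ w1) m @ rev w3) @ (u1 @ rev u1)"
        using W2 Suc u2 w1 by (simp add: word_pow_Suc_right)
      then have "suffix (u1 @ rev u1) (w1 @ w2)"
        by (metis suffixI)
      from suffix_length_suffix[OF this suf_w3] have "suffix (u1 @ rev u1) (w3 @ rev u1)"
        using len(2) lenw(2) by simp
      then show ?thesis
        by simp
    qed
    then obtain s where s: "w3 = s @ u1"
      by (auto simp: suffix_def)
    obtain t where "w4 = hat u1 @ t"
      using \<open>prefix (hat u1) w4\<close> by (auto simp: prefix_def)
    with s have "circ_eq P ((w1 @ w2 @ s) @ u1 @ hat u1 @ t @ w 5 @ w 6 @ w 7 @ w 8)"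
      using fac(1) by simp
    then have "u1 = []"
      by (rule boundary_word_no_backtrack[OF bdry]) (simp add: ne)
    \<comment> \<open>With \<open>u1\<close> empty, \<open>n 2 = 0\<close> would give an empty
      \<open>w2\<close>, and \<open>n 2 > 0\<close> forces \<open>n 1 = 0\<close> and hence an empty
      \<open>w1\<close>.\<close>
    then have "u2 = []" "n 2 > 0 \<Longrightarrow> w1 = []"
      using u2 W1 excl by auto
    then show False
      using W2 ne by (cases "n 2 = 0") auto
  qed

  have p_ne: "p \<noteq> []"
  proof
    assume "p = []"
    with p have u4: "u4 = hat u1"
      by simp
    have "prefix (bar u1) w3"
    proof (cases "n 4")
      case 0
      then have "suffix (hat u1) w4"
        using W4 u4 by simp
      then show ?thesis
        using palindrome_append_prefix[OF pal34] len(2) lenw(2) by (fastforce simp: hat_eq)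
    next
      case (Suc m)
      then have n: "n 1 = 0" "n 3 = 0"
        using excl by auto
      then have w1: "w1 = u1"
        using W1 by simp
      \<comment> \<open>\<open>hat u1 @ bar u1\<close> is itself a palindrome, so as a suffix of
        \<open>w4 @ bar w1\<close> it is also a prefix. It is compared with the first period
        \<open>hat u1 @ w3\<close> of \<open>w4\<close>.\<close>
      have "suffix (hat u1 @ bar u1) (w4 @ bar w1)"
        using suf(4) u4 w1 by (auto simp: suffix_def)
      then have "prefix (rev (hat u1 @ bar u1)) (w4 @ bar w1)"
        using pal45 by (metis palindrome_def suffix_to_prefix)
      then have pre_u1: "prefix (hat u1 @ bar u1) (w4 @ bar w1)"
        by (simp add: hat_eq)
      have "prefix (hat u1 @ w3) (w4 @ bar w1)"
        using W4 Suc w1 by (metis append_assoc prefixI word_pow_Suc)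
      from prefix_length_prefix[OF pre_u1 this] have "prefix (hat u1 @ bar u1) (hat u1 @ w3)"
        using len(2) lenw(2) by simp
      then show ?thesis
        by simp
    qed
    then obtain s where s: "w3 = bar u1 @ s"
      by (auto simp: prefix_def)
    obtain t where "w2 = t @ rev u1"
      using \<open>suffix (rev u1) w2\<close> by (auto simp: suffix_def)
    \<comment> \<open>This time the path turns back between \<open>w2\<close> and \<open>w3\<close>,
      because \<open>hat (rev u1) = bar u1\<close>.\<close>
    with s have "circ_eq P ((w1 @ t) @ rev u1 @ hat (rev u1) @ s @ w4 @ w 5 @ w 6 @ w 7 @ w 8)"
      using fac(1) by (simp add: hat_eq bar_rev)
    then have "rev u1 = []"
      by (rule boundary_word_no_backtrack[OF bdry]) (simp add: ne)
    then have "u4 = []" "n 4 > 0 \<Longrightarrow> w1 = []"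
      using u4 W1 excl by (auto simp: hat_eq)
    then show False
      using W4 ne by (cases "n 4 = 0") auto
  qed

  \<comment> \<open>Palindromicity of \<open>k\<close> and \<open>p\<close>\<close>
  have both_pal: "rev k = k \<and> rev p = p" if n1: "n 1 = Suc m" for m
  proof -
    have n: "n 2 = 0" "n 4 = 0"
      using n1 excl by auto
    then have w2: "w2 = k @ rev u1" and w4: "w4 = hat u1 @ bar p"
      using W2 W4 k p by auto
    \<comment> \<open>\<open>?z\<close> is the period of \<open>bar w1\<close>. As \<open>w4\<close>
      equals the second half of \<open>?z\<close>, the palindrome \<open>w4 @ bar w1\<close> starts
      and ends with known words of length \<open>length ?z\<close>; matching one with the reverse of
      the other, block by block, gives both claims.\<close>
    let ?z = "bar u1 @ bar (rev k) @ hat u1 @ bar p"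
    have z: "bar (rev w2 @ bar w4) = ?z"
      by (simp add: w2 w4 hat_eq bar_rev)
    have w1: "bar w1 = word_pow ?z (Suc m) @ bar u1"
      using arg_cong[OF W1, of bar] n1 z by (simp add: bar_word_pow)
    have "prefix (hat u1 @ bar p @ bar u1 @ bar (rev k)) (w4 @ bar w1)"
      using w4 w1 by (simp add: word_pow_Suc)
    moreover have "suffix (bar (rev k) @ hat u1 @ bar p @ bar u1) (w4 @ bar w1)"
      using w1 unfolding word_pow_Suc_right by (auto simp: suffix_def)
    ultimately have "bar (rev k) @ hat u1 @ bar p @ bar u1 = rev (hat u1 @ bar p @ bar u1 @ bar (rev k))"
      using pal45 by (intro palindrome_prefix_suffix_eq) (auto simp: hat_eq)
    then show ?thesis
      by (simp add: hat_eq bar_rev bar_eq_iff flip: bar_rev)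
  qed
  have pal_k: "rev k = k" if "n 2 = 0"
  proof (cases "n 1")
    case 0
    then have "w1 = u1" "w2 = k @ rev u1"
      using W1 W2 that k by auto
    then show ?thesis
      using pal12 by (simp add: palindrome_def)
  qed (use both_pal in blast)
  have pal_p: "rev p = p" if "n 4 = 0"
  proof (cases "n 1")
    case 0
    then have "w1 = u1" "w4 = hat u1 @ bar p"
      using W1 W4 that p by auto
    then show ?thesis
      using pal45 by (simp add: palindrome_def hat_eq bar_eq_iff flip: bar_rev)
  qed (use both_pal in blast)

  have w1_0: "w1 = u1" if "n 1 = 0" using W1 that by simp
  have w2_0: "w2 = k @ rev u1" if "n 2 = 0" using W2 k that by simp
  have w3_0: "w3 = u3" if "n 3 = 0" using W3 that by simp
  have w4_0: "w4 = hat u1 @ bar p" if "n 4 = 0" using W4 p that by simp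
  \<comment> \<open>The period \<open>rev w2 @ bar w4\<close> unfolds to
    \<open>u1 @ rev k @ rev u1 @ p\<close>, and \<open>k\<close> is a palindrome here; for
    \<open>w3\<close> the same happens with \<open>p\<close>.\<close>
  have w1_form: "w1 = word_pow (u1 @ k @ rev u1 @ p) (n 1) @ u1" if "n 2 = 0" "n 4 = 0"
    by (subst W1) (use that w2_0 w4_0 pal_k in \<open>simp add: hat_eq bar_rev\<close>)
  have w3_form: "w3 = word_pow (bar p @ bar u1 @ k @ rev u1) (n 3) @ u3" if "n 2 = 0" "n 4 = 0"
    by (subst W3) (use that w2_0 w4_0 pal_p in \<open>simp add: hat_eq flip: bar_rev\<close>)
  have w2_form: "w2 = word_pow (rev u3 @ u1) (n 2) @ k @ rev u1" if "n 1 = 0" "n 3 = 0"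
    by (subst W2) (use that w1_0 w3_0 k in simp)
  have w4_form: "w4 = word_pow (hat u1 @ u3) (n 4) @ hat u1 @ bar p" if "n 1 = 0" "n 3 = 0"
    by (subst W4) (use that w1_0 w3_0 p in simp)
  show ?thesis
    unfolding defs[symmetric] palindrome_def
  proof (rule exI[of _ k], rule exI[of _ p], intro conjI k_ne p_ne k p, goal_cases)
    case 1
    \<comment> \<open>Each alternative leaves two free exponents, and their four zero patterns each
      select one disjunct; the all-zero pattern occurs in both.\<close>
    from excl show ?case
    proof
      assume "n 1 = 0 \<and> n 3 = 0"
      with w1_0 w3_0 w2_form w4_form w2_0 w4_0 pal_k pal_p show ?thesis
        by (cases "n 2 = 0"; cases "n 4 = 0") simp_all
    next
      assume "n 2 = 0 \<and> n 4 = 0"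
      with w2_0 w4_0 w1_form w3_form w1_0 w3_0 pal_k pal_p show ?thesis
        by (cases "n 1 = 0"; cases "n 3 = 0") simp_all
    qed
  qed
qed

end
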